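(* Let $P = \{ p_{1}, \ldots, p_{d} \}$ and $Q = \{ q_{1}, \ldots, q_{d} \}$ be finite partially ordered sets with $|P| = |Q| = d$. If $P$ and $Q$ possess a common linear extension, then the twinned order polytope $\Delta(P,-Q) \subset \mathbb{R}^d$ is a normal Gorenstein Fano polytope.
   Context: A subset $I$ of a finite poset $P$ is a poset ideal of $P$ if $p_i \in I$ and $p_j \in P$ with $p_j \le p_i$ imply $p_j \in I$; in particular $\emptyset$ and $P$ are poset ideals. Let $\mathcal{J}(P)$ and $\mathcal{J}(Q)$ denote the sets of poset ideals of $P$ and $Q$. A linear extension of $P = \{p_1,\ldots,p_d\}$ is a permutation $\sigma = i_1 i_2 \cdots i_d$ of $[d]=\{1,\ldots,d\}$ such that $a < b$ whenever $p_{i_a} < p_{i_b}$ in $P$; likewise for $Q = \{q_1,\ldots,q_d\}$ (with $q$ in place of $p$). $P$ and $Q$ possess a common linear extension if some permutation of $[d]$ is a linear extension of both. The labelings of $P$ and $Q$ by $1,\ldots,d$ are fixed. Let $\mathbf{e}_1,\ldots,\mathbf{e}_d$ be the canonical unit coordinate vectors of $\mathbb{R}^d$. For $I \subset P$ put $\rho(I) = \sum_{p_i \in I} \mathbf{e}_i$, and for $J \subset Q$ put $\rho(J) = \sum_{q_j \in J} \mathbf{e}_j$. Define $$\Omega(P,-Q) = \{ \rho(I) : \emptyset \ne I \in \mathcal{J}(P) \} \cup \{ -\rho(J) : \emptyset \neq J \in \mathcal{J}(Q) \} \cup \{ \mathbf{0} \} \subset \mathbb{Z}^d.$$ The twinned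 order polytope $\Delta(P,-Q) \subset \mathbb{R}^d$ is the convex hull of $\Omega(P,-Q)$. An integral convex polytope $\Delta \subset \mathbb{R}^d$ (all vertices in $\mathbb{Z}^d$) of dimension $d$ is a Fano polytope if the origin of $\mathbb{R}^d$ is the unique integer point in the interior of $\Delta$. A Fano polytope $\Delta$ is Gorenstein if its dual polytope $\Delta^\vee = \{ x \in \mathbb{R}^d : \langle x, y \rangle \le 1 \text{ for all } y \in \Delta \}$ is an integral polytope. An integral convex polytope $\Delta$ is normal if for every integer $N \geq 1$ and every $\alpha \in N\Delta \cap \mathbb{Z}^d$ there exist $\alpha_1,\ldots,\alpha_N \in \Delta \cap \mathbb{Z}^d$ with $\alpha = \alpha_1 + \cdots + \alpha_N$. *)

theory Defs
  imports "HOL-Analysis.Analysis"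
begin

text \<open>
  A poset is a carrier set \<open>P\<close> with a relation \<open>r\<close> such that \<open>partial_order_on P r\<close>;
  \<open>(x, y) \<in> r\<close> means \<open>x \<le> y\<close>. Its elements are labelled by a bijection \<open>p\<close> from the
  finite index type \<open>'n\<close> (playing the role of \<open>[d]\<close>, \<open>d = CARD('n)\<close>) onto \<open>P\<close>, so
  that \<open>p i\<close> is $p_i$.
\<close>

definition poset_ideal :: "'a set \<Rightarrow> 'a rel \<Rightarrow> 'a set \<Rightarrow> bool" where
  "poset_ideal P r I \<longleftrightarrow> I \<subseteq> P \<and> (\<forall>x\<in>I. \<forall>y\<in>P. (y, x) \<in> r \<longrightarrow> y \<in> I)"

text \<open>
  A permutation $i_1 i_2 \cdots i_d$ of the labels is the bijection \<open>\<sigma>\<close> from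
  \<open>{1..d}\<close> to \<open>'n\<close> with $\sigma(a) = i_a$.
\<close>

definition linear_extension :: "'a rel \<Rightarrow> ('n::finite \<Rightarrow> 'a) \<Rightarrow> (nat \<Rightarrow> 'n) \<Rightarrow> bool" where
  "linear_extension r p \<sigma> \<longleftrightarrow>
     bij_betw \<sigma> {1..CARD('n)} UNIV \<and>
     (\<forall>a\<in>{1..CARD('n)}. \<forall>b\<in>{1..CARD('n)}.
        (p (\<sigma> a), p (\<sigma> b)) \<in> r \<and> p (\<sigma> a) \<noteq> p (\<sigma> b) \<longrightarrow> a < b)"

definition common_linear_extension ::
  "'a rel \<Rightarrow> ('n::finite \<Rightarrow> 'a) \<Rightarrow> 'b rel \<Rightarrow> ('n \<Rightarrow> 'b) \<Rightarrow> bool" where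
  "common_linear_extension r p s q \<longleftrightarrow>
     (\<exists>\<sigma>. linear_extension r p \<sigma> \<and> linear_extension s q \<sigma>)"

definition ideal_vector :: "('n::finite \<Rightarrow> 'a) \<Rightarrow> 'a set \<Rightarrow> real ^ 'n" where
  "ideal_vector p I = (\<Sum>i | p i \<in> I. axis i 1)"

definition twinned_points ::
  "'a set \<Rightarrow> 'a rel \<Rightarrow> ('n::finite \<Rightarrow> 'a) \<Rightarrow> 'b set \<Rightarrow> 'b rel \<Rightarrow> ('n \<Rightarrow> 'b) \<Rightarrow> (real ^ 'n) set" where
  "twinned_points P r p Q s q =
     {ideal_vector p I | I. I \<noteq> {} \<and> poset_ideal P r I} \<union>
     {- ideal_vector q J | J. J \<noteq> {} \<and> poset_ideal Q s J} \<union> {0}"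

definition twinned_order_polytope ::
  "'a set \<Rightarrow> 'a rel \<Rightarrow> ('n::finite \<Rightarrow> 'a) \<Rightarrow> 'b set \<Rightarrow> 'b rel \<Rightarrow> ('n \<Rightarrow> 'b) \<Rightarrow> (real ^ 'n) set" where
  "twinned_order_polytope P r p Q s q = convex hull (twinned_points P r p Q s q)"

definition integer_point :: "real ^ 'n \<Rightarrow> bool" where
  "integer_point x \<longleftrightarrow> (\<forall>i. x $ i \<in> \<int>)"

definition integral_polytope :: "(real ^ 'n::finite) set \<Rightarrow> bool" where
  "integral_polytope D \<longleftrightarrow> polytope D \<and> (\<forall>v. v extreme_point_of D \<longrightarrow> integer_point v)"

definition fano_polytope :: "(real ^ 'n::finite) set \<Rightarrow> bool" where
  "fano_polytope D \<longleftrightarrow>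
     integral_polytope D \<and> aff_dim D = int CARD('n) \<and> {x \<in> interior D. integer_point x} = {0}"

definition dual_polytope :: "(real ^ 'n::finite) set \<Rightarrow> (real ^ 'n) set" where
  "dual_polytope D = {x. \<forall>y\<in>D. x \<bullet> y \<le> 1}"

definition gorenstein_fano_polytope :: "(real ^ 'n::finite) set \<Rightarrow> bool" where
  "gorenstein_fano_polytope D \<longleftrightarrow> fano_polytope D \<and> integral_polytope (dual_polytope D)"

definition normal_polytope :: "(real ^ 'n::finite) set \<Rightarrow> bool" where
  "normal_polytope D \<longleftrightarrow>
     integral_polytope D \<and>
     (\<forall>N::nat. N \<ge> 1 \<longrightarrow>
       (\<forall>\<alpha> \<in> (\<lambda>x. real N *\<^sub>R x) ` D. integer_point \<alpha> \<longrightarrow>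
         (\<exists>\<beta> :: nat \<Rightarrow> real ^ 'n.
            (\<forall>k\<in>{1..N}. \<beta> k \<in> D \<and> integer_point (\<beta> k)) \<and> \<alpha> = (\<Sum>k=1..N. \<beta> k))))"

end

theory Submission
  imports Defs
begin

text \<open>
  Everything rests on one rounding argument.  Write \<open>D\<close> for the twinned order polytope.  It is the
  convex hull of the order polytope of \<open>P\<close> and the negative of the order polytope of \<open>Q\<close>, so a
  point of \<open>r D\<close> has the form \<open>x - y\<close>, where \<open>x\<close> reverses the order of \<open>P\<close> and has entries
  in \<open>[0, a]\<close>, \<open>y\<close> reverses the order of \<open>Q\<close> and has entries in \<open>[0, b]\<close>, and \<open>a + b = r\<close>.
  If \<open>x - y\<close> is an integer point, then \<open>x\<close> and \<open>y\<close> have equal fractional parts, so rounding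
  both down entrywise leaves the difference unchanged.  An integral order-reversing vector is the sum
  of the indicators of its superlevel sets, which are poset ideals.  Hence an integer point of
  \<open>r D\<close> is a sum of \<open>\<lfloor>r\<rfloor>\<close> points of \<open>\<Omega>(P,-Q)\<close>, for every real \<open>r \<ge> 0\<close>
  (\<open>floor_decomposable_twinned_points\<close>).

  For integral \<open>r\<close> this is normality.  For non-integral \<open>r\<close> it says that the gauge of \<open>D\<close> takes
  integer values at integer points, and this makes the dual polytope integral by the argument of
  Edmonds and Giles (\<open>integral_polytope_dual_polytope\<close>): at a vertex \<open>v\<close> of the dual, the points
  \<open>a\<close> of \<open>\<Omega>(P,-Q)\<close> with \<open>v \<bullet> a = 1\<close> span the space, so there is an integer vector
  \<open>c\<close> such that both \<open>c\<close> and \<open>c + e\<^sub>i\<close> are nonnegative combinations of them.  The gauge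
  at such a vector equals its inner product with \<open>v\<close>, so \<open>v\<^sub>i\<close> is a difference of integers.

  The common linear extension makes the origin an interior point.  Its initial
  segments are ideals of both posets, and \<open>e\<^sub>i\<close> is the difference of the indicators of two
  consecutive ones, so \<open>D\<close> contains all \<open>\<plusminus>e\<^sub>i / 2\<close>.  There is no other interior integer
  point because \<open>D\<close> lies in the cube \<open>[-1, 1]\<^sup>d\<close>.
\<close>

section \<open>Integer points in real dilates of a lattice polytope\<close>

text \<open>
  The dilation factor \<open>r\<close> ranges over the reals: integral values of \<open>r\<close> give normality, while
  the remaining ones express that the gauge of the polytope is integral at integer points.
\<close>

definition floor_decomposable :: "(real ^ 'n::finite) set \<Rightarrow> bool" where
  "floor_decomposable S \<longleftrightarrow>
     (\<forall>r\<ge>0. \<forall>z \<in> (\<lambda>x. r *\<^sub>R x) ` (convex hull S). integer_point z \<longrightarrow>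
        (\<exists>xs. set xs \<subseteq> S \<and> length xs = nat \<lfloor>r\<rfloor> \<and> z = sum_list xs))"

lemma integer_point_add: "integer_point x \<Longrightarrow> integer_point y \<Longrightarrow> integer_point (x + y)"
  by (simp add: integer_point_def)

lemma integer_point_scaleR: "c \<in> \<int> \<Longrightarrow> integer_point x \<Longrightarrow> integer_point (c *\<^sub>R x)"
  by (simp add: integer_point_def)

lemma integer_point_sum: "(\<And>x. x \<in> A \<Longrightarrow> integer_point (f x)) \<Longrightarrow> integer_point (sum f A)"
  by (auto simp: integer_point_def intro!: Ints_sum)

lemma integer_point_axis: "integer_point (axis i 1)"
  by (auto simp: integer_point_def axis_def)

lemma integral_polytope_convex_hull:
  assumes "finite S" "\<And>x. x \<in> S \<Longrightarrow> integer_point x"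
  shows "integral_polytope (convex hull S)"
  using assms extreme_point_of_convex_hull
  unfolding integral_polytope_def polytope_def by blast

lemma normal_polytope_convex_hull:
  assumes "finite S" "\<And>x. x \<in> S \<Longrightarrow> integer_point x" "floor_decomposable S"
  shows "normal_polytope (convex hull S)"
  unfolding normal_polytope_def
proof (intro conjI allI impI ballI)
  show "integral_polytope (convex hull S)"
    using assms integral_polytope_convex_hull by blast
next
  fix N :: nat and z
  assume "1 \<le> N" and z: "z \<in> (\<lambda>x. real N *\<^sub>R x) ` (convex hull S)" "integer_point z"
  then obtain xs where xs: "set xs \<subseteq> S" "length xs = N" "z = sum_list xs"
    using assms(3) unfolding floor_decomposable_def
    by (metis floor_of_nat nat_int of_nat_0_le_iff)
  define \<beta> where "\<beta> = (\<lambda>k. xs ! (k - 1))"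
  have "\<beta> k \<in> S" if "k \<in> {1..N}" for k
    using that xs nth_mem[of "k - 1" xs] by (auto simp: \<beta>_def)
  moreover have "z = (\<Sum>k=1..N. \<beta> k)"
    using xs(2) by (simp add: xs(3) \<beta>_def sum_list_sum_nth sum.atLeast1_atMost_eq lessThan_atLeast0)
  ultimately show "\<exists>\<beta>. (\<forall>k\<in>{1..N}. \<beta> k \<in> convex hull S \<and> integer_point (\<beta> k))
      \<and> z = (\<Sum>k=1..N. \<beta> k)"
    using assms(2) hull_inc by metis
qed

lemma nonneg_combination_in_dilate:
  assumes "finite T" "T \<subseteq> S" "S \<noteq> {}" "\<And>a. a \<in> T \<Longrightarrow> 0 \<le> u a"
  shows "(\<Sum>a\<in>T. u a *\<^sub>R a) \<in> (\<lambda>x. sum u T *\<^sub>R x) ` (convex hull S)"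
proof (cases "sum u T = 0")
  case True
  then have "\<forall>a\<in>T. u a = 0"
    using assms(1,4) by (simp add: sum_nonneg_eq_0_iff)
  then show ?thesis
    using assms(3) True by (auto simp: image_iff)
next
  case False
  have "(\<Sum>a\<in>T. (u a / sum u T) *\<^sub>R a) \<in> convex hull S"
    using assms False
    by (intro convex_sum) (auto simp: sum_divide_distrib[symmetric] sum_nonneg hull_inc)
  moreover have "(\<Sum>a\<in>T. u a *\<^sub>R a) = sum u T *\<^sub>R (\<Sum>a\<in>T. (u a / sum u T) *\<^sub>R a)"
    using False by (simp add: scaleR_right.sum)
  ultimately show ?thesis by blast
qed

section \<open>Integrality of the dual polytope\<close>

lemma dual_polytope_convex_hull: "dual_polytope (convex hull S) = {x. \<forall>a\<in>S. x \<bullet> a \<le> 1}"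
proof -
  have "convex hull S \<subseteq> {y. x \<bullet> y \<le> 1}" if "\<forall>a\<in>S. x \<bullet> a \<le> 1" for x
    using that by (intro hull_minimal convex_halfspace_le) auto
  then show ?thesis
    unfolding dual_polytope_def by (auto simp: hull_inc)
qed

lemma polytope_dual_polytope:
  fixes S :: "(real ^ 'n::finite) set"
  assumes "finite S" "0 \<in> interior (convex hull S)"
  shows "polytope (dual_polytope (convex hull S))"
proof -
  have "dual_polytope (convex hull S) = \<Inter> ((\<lambda>a. {x. a \<bullet> x \<le> 1}) ` S)"
    unfolding dual_polytope_convex_hull by (auto simp: inner_commute)
  then have "polyhedron (dual_polytope (convex hull S))"
    using assms(1) by (auto intro!: polyhedron_Inter polyhedron_halfspace_le)
  moreover
  obtain e where e: "0 < e" "cball 0 e \<subseteq> convex hull S"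
    using assms(2) by (meson mem_interior_cball)
  have "norm x \<le> 1 / e" if "x \<in> dual_polytope (convex hull S)" for x
  proof (cases "x = 0")
    case False
    have "(e / norm x) *\<^sub>R x \<in> convex hull S"
      using e(1) False by (intro subsetD[OF e(2)]) simp
    then have "x \<bullet> ((e / norm x) *\<^sub>R x) \<le> 1"
      using that unfolding dual_polytope_def by blast
    then have "e * norm x \<le> 1"
      using False by (simp add: dot_square_norm power2_eq_square)
    then show ?thesis
      using e(1) by (simp add: field_simps)
  qed (use e in simp)
  then have "bounded (dual_polytope (convex hull S))"
    by (auto simp: bounded_iff)
  ultimately show ?thesis
    by (simp add: polytope_eq_bounded_polyhedron)
qed

text \<open>
  Otherwise some \<open>u \<noteq> 0\<close> is orthogonal to all tight constraints, and \<open>v\<close> can be moved a little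
  in both directions \<open>\<plusminus>u\<close>: the finitely many other constraints have slack.
\<close>

lemma span_tight_constraints:
  fixes S :: "(real ^ 'n::finite) set"
  assumes "finite S" and v: "v extreme_point_of {x. \<forall>a\<in>S. x \<bullet> a \<le> 1}"
  shows "span {a \<in> S. v \<bullet> a = 1} = UNIV"
proof (rule ccontr)
  define T where "T = {a \<in> S. v \<bullet> a = 1}"
  assume "\<not> ?thesis"
  then have "dim T \<noteq> DIM(real ^ 'n)"
    by (simp only: T_def dim_eq_full not_False_eq_True)
  then have "dim T < DIM(real ^ 'n)"
    using dim_subset_UNIV[of T] by linarith
  then obtain u where u: "u \<noteq> 0" "\<And>y. y \<in> span T \<Longrightarrow> orthogonal u y"
    using orthogonal_to_subspace_exists by blast
  have uT: "u \<bullet> a = 0" if "a \<in> S" "v \<bullet> a = 1" for a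
    using u(2)[of a] that by (simp add: orthogonal_def T_def span_base)
  have vS: "v \<bullet> a \<le> 1" if "a \<in> S" for a
    using v that by (auto simp: extreme_point_of_def)
  have "\<forall>\<^sub>F e in at_right 0. \<forall>a\<in>S. v \<bullet> a + e * \<bar>u \<bullet> a\<bar> \<le> 1"
  proof (rule eventually_ball_finite[OF assms(1)], rule ballI)
    fix a assume a: "a \<in> S"
    show "\<forall>\<^sub>F e in at_right 0. v \<bullet> a + e * \<bar>u \<bullet> a\<bar> \<le> 1"
    proof (cases "v \<bullet> a = 1")
      case True
      then show ?thesis using uT[OF a] by simp
    next
      case False
      then have "v \<bullet> a + 0 * \<bar>u \<bullet> a\<bar> < 1"
        using vS[OF a] by simp
      moreover have "((\<lambda>e. v \<bullet> a + e * \<bar>u \<bullet> a\<bar>) \<longlongrightarrow> v \<bullet> a + 0 * \<bar>u \<bullet> a\<bar>) (at_right 0)"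
        by (intro tendsto_intros)
      ultimately have "\<forall>\<^sub>F e in at_right 0. v \<bullet> a + e * \<bar>u \<bullet> a\<bar> < 1"
        by (rule order_tendstoD(2)[rotated])
      then show ?thesis by (rule eventually_mono) simp
    qed
  qed
  then have "\<forall>\<^sub>F e in at_right 0. 0 < e \<and> (\<forall>a\<in>S. v \<bullet> a + e * \<bar>u \<bullet> a\<bar> \<le> 1)"
    by (intro eventually_conj eventually_at_right_less)
  then obtain e :: real where e: "0 < e" "\<And>a. a \<in> S \<Longrightarrow> v \<bullet> a + e * \<bar>u \<bullet> a\<bar> \<le> 1"
    using eventually_happens'[OF trivial_limit_at_right_real] by blast
  have "v \<bullet> a + c * (u \<bullet> a) \<le> 1" if "a \<in> S" "\<bar>c\<bar> = e" for a c
    using e(2)[OF that(1)] abs_ge_self[of "c * (u \<bullet> a)"] that(2) by (simp add: abs_mult)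
  then have "v + c *\<^sub>R u \<in> {x. \<forall>a\<in>S. x \<bullet> a \<le> 1}" if "\<bar>c\<bar> = e" for c
    using that by (simp add: inner_left_distrib)
  from this[of e] this[of "- e"]
  have "v + e *\<^sub>R u \<in> {x. \<forall>a\<in>S. x \<bullet> a \<le> 1}" "v - e *\<^sub>R u \<in> {x. \<forall>a\<in>S. x \<bullet> a \<le> 1}"
    using e(1) by auto
  moreover have "v \<in> open_segment (v - e *\<^sub>R u) (v + e *\<^sub>R u)"
  proof -
    have "v = midpoint (v - e *\<^sub>R u) (v + e *\<^sub>R u)"
      by (simp add: midpoint_def)
    moreover have "v - e *\<^sub>R u \<noteq> v + e *\<^sub>R u"
    proof
      assume eq: "v - e *\<^sub>R u = v + e *\<^sub>R u"
      have "u $ i = 0" for i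
        using arg_cong[OF eq, of "\<lambda>x. x $ i"] e(1) by simp
      then show False using u(1) by (simp add: vec_eq_iff)
    qed
    ultimately show ?thesis
      by (metis midpoint_in_open_segment)
  qed
  ultimately show False
    using v by (auto simp: extreme_point_of_def)
qed

text \<open>
  Let \<open>c\<close> be a nonnegative combination, with coefficient sum \<open>r\<close>, of points at which the
  constraint \<open>v \<bullet> a \<le> 1\<close> is tight.  Then \<open>v \<bullet> c = r\<close>.  If \<open>c\<close> is integral, it is also a sum
  of only \<open>\<lfloor>r\<rfloor>\<close> points of \<open>S\<close>, whence \<open>r = v \<bullet> c \<le> \<lfloor>r\<rfloor>\<close> and \<open>r\<close> is an integer.
\<close>

lemma integral_value_on_tight_cone:
  fixes S :: "(real ^ 'n::finite) set"
  assumes "finite S" "floor_decomposable S"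
    and v: "\<And>a. a \<in> S \<Longrightarrow> v \<bullet> a \<le> 1"
    and T: "T \<subseteq> S" "\<And>a. a \<in> T \<Longrightarrow> v \<bullet> a = 1" "T \<noteq> {}"
    and u: "\<And>a. a \<in> T \<Longrightarrow> 0 \<le> u a"
    and int: "integer_point (\<Sum>a\<in>T. u a *\<^sub>R a)"
  shows "v \<bullet> (\<Sum>a\<in>T. u a *\<^sub>R a) \<in> \<int>"
proof -
  let ?c = "\<Sum>a\<in>T. u a *\<^sub>R a" and ?r = "sum u T"
  have val: "v \<bullet> ?c = ?r"
    using T(2) by (simp add: inner_sum_right)
  have r: "0 \<le> ?r"
    using u by (simp add: sum_nonneg)
  have "?c \<in> (\<lambda>x. ?r *\<^sub>R x) ` (convex hull S)"
    using assms(1) T u by (intro nonneg_combination_in_dilate) (auto intro: finite_subset)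
  then obtain xs where xs: "set xs \<subseteq> S" "length xs = nat \<lfloor>?r\<rfloor>" "?c = sum_list xs"
    using assms(2) int r unfolding floor_decomposable_def by blast
  have "v \<bullet> sum_list xs \<le> real (length xs)"
    using xs(1) by (induction xs) (auto simp: inner_right_distrib dest!: v)
  then have "?r \<le> of_int \<lfloor>?r\<rfloor>"
    using val xs(2,3) r by simp
  then have "?r = of_int \<lfloor>?r\<rfloor>"
    using of_int_floor_le[of ?r] by linarith
  then show ?thesis
    using val by (metis Ints_of_int)
qed

lemma integral_polytope_dual_polytope:
  fixes S :: "(real ^ 'n::finite) set"
  assumes "finite S" and int: "\<And>x. x \<in> S \<Longrightarrow> integer_point x" and "floor_decomposable S"
    and "0 \<in> interior (convex hull S)"
  shows "integral_polytope (dual_polytope (convex hull S))"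
  unfolding integral_polytope_def
proof (intro conjI allI impI)
  show "polytope (dual_polytope (convex hull S))"
    using assms polytope_dual_polytope by blast
next
  fix v assume "v extreme_point_of dual_polytope (convex hull S)"
  then have v: "v extreme_point_of {x. \<forall>a\<in>S. x \<bullet> a \<le> 1}"
    by (simp add: dual_polytope_convex_hull)
  define T where "T = {a \<in> S. v \<bullet> a = 1}"
  have T: "finite T" "T \<subseteq> S" "\<And>a. a \<in> T \<Longrightarrow> v \<bullet> a = 1"
    using assms(1) by (auto simp: T_def)
  have spanT: "span T = UNIV"
    using span_tight_constraints[OF assms(1) v] by (simp add: T_def)
  have vS: "v \<bullet> a \<le> 1" if "a \<in> S" for a
    using v that by (auto simp: extreme_point_of_def)
  have "T \<noteq> {}"
  proof
    assume "T = {}"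
    then have "axis undefined (1::real) \<in> span ({} :: (real ^ 'n) set)"
      using spanT by auto
    then show False by (simp add: axis_eq_0_iff)
  qed
  show "integer_point v"
    unfolding integer_point_def
  proof
    fix i :: 'n
    have "axis i 1 \<in> span T" using spanT by simp
    then obtain l where l: "(\<Sum>a\<in>T. l a *\<^sub>R a) = axis i 1"
      using span_finite[OF T(1)] by (metis (mono_tags, lifting) imageE)
    \<comment> \<open>A multiple of \<open>\<Sum>T\<close> large enough to make every coefficient of \<open>M \<Sum>T + e\<^sub>i\<close> nonnegative.\<close>
    define M :: real where "M = of_nat (nat \<lceil>\<Sum>a\<in>T. \<bar>l a\<bar>\<rceil>)"
    have M: "0 \<le> M + l a" if "a \<in> T" for a
    proof -
      have "\<bar>l a\<bar> \<le> (\<Sum>a\<in>T. \<bar>l a\<bar>)"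
        using that T(1) by (intro member_le_sum) auto
      also have "\<dots> \<le> M" unfolding M_def by linarith
      finally show ?thesis by linarith
    qed
    have "M \<in> \<int>" by (simp add: M_def)
    have c: "(\<Sum>a\<in>T. (M + l a) *\<^sub>R a) = M *\<^sub>R \<Sum>T + axis i 1"
      by (simp add: scaleR_left_distrib sum.distrib l scaleR_right.sum)
    have "integer_point (\<Sum>a\<in>T. (M + l a) *\<^sub>R a)"
      unfolding c using \<open>M \<in> \<int>\<close> int T(2)
      by (intro integer_point_add integer_point_scaleR integer_point_sum integer_point_axis) auto
    then have "v \<bullet> (\<Sum>a\<in>T. (M + l a) *\<^sub>R a) \<in> \<int>"
      by (intro integral_value_on_tight_cone[OF assms(1,3)]) (use vS T \<open>T \<noteq> {}\<close> M in auto)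
    moreover have "v \<bullet> (\<Sum>a\<in>T. (M + l a) *\<^sub>R a) = M * of_nat (card T) + v $ i"
      unfolding c using T(3) by (simp add: inner_right_distrib inner_sum_right inner_axis)
    ultimately have "M * of_nat (card T) + v $ i - M * of_nat (card T) \<in> \<int>"
      using \<open>M \<in> \<int>\<close> by (intro Ints_diff Ints_mult) auto
    then show "v $ i \<in> \<int>" by simp
  qed
qed

section \<open>Rounding in the order polytope\<close>

definition ideal_points :: "'a set \<Rightarrow> 'a rel \<Rightarrow> ('n::finite \<Rightarrow> 'a) \<Rightarrow> (real ^ 'n) set" where
  "ideal_points P r p = ideal_vector p ` Collect (poset_ideal P r)"

lemma ideal_vector_nth: "ideal_vector p I $ i = of_bool (p i \<in> I)"
  by (simp add: ideal_vector_def axis_def of_bool_def sum.delta' if_distrib cong: if_cong)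

text \<open>The empty ideal accounts for the origin.\<close>

lemma ideal_points_eq_insert:
  "ideal_points P r p = insert 0 {ideal_vector p I | I. I \<noteq> {} \<and> poset_ideal P r I}"
proof -
  have "Collect (poset_ideal P r) = insert {} {I. I \<noteq> {} \<and> poset_ideal P r I}"
    by (auto simp: poset_ideal_def)
  then have "ideal_points P r p = insert (ideal_vector p {})
      (ideal_vector p ` {I. I \<noteq> {} \<and> poset_ideal P r I})"
    unfolding ideal_points_def by simp
  moreover have "ideal_vector p {} = 0"
    by (simp add: ideal_vector_def)
  ultimately show ?thesis
    by (simp add: image_Collect)
qed

lemma zero_in_ideal_points: "0 \<in> ideal_points P r p"
  by (simp add: ideal_points_eq_insert)

lemma finite_ideal_points:
  assumes "finite P"
  shows "finite (ideal_points P r p)"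
proof -
  have "Collect (poset_ideal P r) \<subseteq> Pow P" by (auto simp: poset_ideal_def)
  then show ?thesis
    unfolding ideal_points_def using assms by (meson finite_Pow_iff finite_imageI finite_subset)
qed

text \<open>
  These are the linear inequalities of the order polytope: they hold for the indicator of an ideal
  and define a convex set.
\<close>

lemma order_polytope_bounds:
  assumes "range p \<subseteq> P" "x \<in> convex hull (ideal_points P r p)"
  shows "0 \<le> x $ i" "x $ i \<le> 1" "(p i, p j) \<in> r \<Longrightarrow> x $ j \<le> x $ i"
proof -
  let ?K = "{x :: real ^ 'b. (\<forall>i. 0 \<le> x $ i) \<and> (\<forall>i. x $ i \<le> 1) \<and>
     (\<forall>i j. (p i, p j) \<in> r \<longrightarrow> x $ j \<le> x $ i)}"
  have "convex ?K"
    unfolding convex_def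
    by (auto intro!: add_mono mult_left_mono convex_bound_le)
  moreover have "ideal_points P r p \<subseteq> ?K"
    using assms(1) by (fastforce simp: ideal_points_def ideal_vector_nth poset_ideal_def)
  ultimately have "convex hull (ideal_points P r p) \<subseteq> ?K"
    by (intro hull_minimal)
  then have "x \<in> ?K"
    using assms(2) by (rule subsetD)
  then show "0 \<le> x $ i" "x $ i \<le> 1" "(p i, p j) \<in> r \<Longrightarrow> x $ j \<le> x $ i"
    by simp_all
qed

lemma sum_of_bool_le_eq:
  assumes "n \<le> m"
  shows "(\<Sum>k\<leftarrow>[1..<Suc m]. of_bool (k \<le> n)) = (of_nat n :: real)"
proof -
  have "(\<Sum>k\<leftarrow>[1..<Suc m]. of_bool (k \<le> n)) = (\<Sum>k\<in>{1..<Suc m}. (of_bool (k \<le> n) :: real))"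
    by (simp only: sum_list_distinct_conv_sum_set distinct_upt set_upt)
  also have "\<dots> = real (card ({1..<Suc m} \<inter> {k. k \<le> n}))"
    by (intro sum_of_bool_eq finite_atLeastLessThan)
  also have "{1..<Suc m} \<inter> {k. k \<le> n} = {1..n}"
    using assms by auto
  finally show ?thesis by simp
qed

lemma sum_list_vec_nth: "sum_list xs $ i = (\<Sum>x\<leftarrow>xs. x $ i)"
  by (induction xs) auto

text \<open>The summands are the indicators of the superlevel sets of the rounded vector.\<close>

lemma floor_of_dilated_order_polytope:
  fixes p :: "'n::finite \<Rightarrow> 'a"
  assumes "bij_betw p UNIV P" "x \<in> convex hull (ideal_points P r p)" "0 \<le> c"
  shows "\<exists>xs. set xs \<subseteq> ideal_points P r p \<and> length xs = nat \<lfloor>c\<rfloor>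
           \<and> sum_list xs = (\<chi> i. of_int \<lfloor>c * x $ i\<rfloor>)"
proof -
  have p: "range p = P" "inj p" using assms(1) by (auto simp: bij_betw_def)
  note x = order_polytope_bounds[OF equalityD1[OF p(1)] assms(2)]
  define h where "h i = nat \<lfloor>c * x $ i\<rfloor>" for i
  define L where "L k = p ` {i. k \<le> h i}" for k
  have h_le: "h i \<le> nat \<lfloor>c\<rfloor>" for i
    unfolding h_def using x(2)[of i] assms(3)
    by (intro nat_mono floor_mono) (simp add: mult_left_le)
  have antitone: "h j \<le> h i" if "(p i, p j) \<in> r" for i j
    unfolding h_def using x(3)[OF that] assms(3)
    by (intro nat_mono floor_mono mult_left_mono)
  have "poset_ideal P r (L k)" for k
    using antitone p(1) by (fastforce simp: poset_ideal_def L_def intro: le_trans)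
  then have "set (map (\<lambda>k. ideal_vector p (L k)) [1..<Suc (nat \<lfloor>c\<rfloor>)]) \<subseteq> ideal_points P r p"
    by (auto simp: ideal_points_def)
  moreover have "sum_list (map (\<lambda>k. ideal_vector p (L k)) [1..<Suc (nat \<lfloor>c\<rfloor>)]) $ i
      = of_int \<lfloor>c * x $ i\<rfloor>" for i
  proof -
    have "ideal_vector p (L k) $ i = of_bool (k \<le> h i)" for k
      using p(2) by (simp add: ideal_vector_nth L_def inj_image_mem_iff)
    then have "sum_list (map (\<lambda>k. ideal_vector p (L k)) [1..<Suc (nat \<lfloor>c\<rfloor>)]) $ i
        = (\<Sum>k\<leftarrow>[1..<Suc (nat \<lfloor>c\<rfloor>)]. of_bool (k \<le> h i))"
      by (simp only: sum_list_vec_nth map_map o_def)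
    also have "\<dots> = real (h i)"
      by (rule sum_of_bool_le_eq[OF h_le])
    also have "\<dots> = of_int \<lfloor>c * x $ i\<rfloor>"
      using assms(3) x(1) by (simp add: h_def)
    finally show ?thesis .
  qed
  moreover have "length (map (\<lambda>k. ideal_vector p (L k)) [1..<Suc (nat \<lfloor>c\<rfloor>)]) = nat \<lfloor>c\<rfloor>"
    by (simp only: length_map length_upt diff_Suc_1 One_nat_def)
  ultimately show ?thesis
    unfolding vec_eq_iff by (metis (no_types, lifting) vec_lambda_beta)
qed

section \<open>The twinned order polytope\<close>

lemma twinned_points_eq:
  "twinned_points P r p Q s q = ideal_points P r p \<union> uminus ` ideal_points Q s q"
proof -
  have "uminus ` {ideal_vector q J | J. J \<noteq> {} \<and> poset_ideal Q s J}
      = {- ideal_vector q J | J. J \<noteq> {} \<and> poset_ideal Q s J}"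
    by blast
  then show ?thesis
    unfolding twinned_points_def ideal_points_eq_insert by simp
qed

lemma integer_point_twinned_points:
  "x \<in> twinned_points P r p Q s q \<Longrightarrow> integer_point x"
  by (auto simp: twinned_points_eq ideal_points_def integer_point_def ideal_vector_nth)

lemma twinned_order_polytope_in_cube:
  fixes x :: "real ^ 'n::finite"
  assumes "x \<in> convex hull (twinned_points P r p Q s q)"
  shows "\<bar>x $ i\<bar> \<le> 1"
proof -
  have "twinned_points P r p Q s q \<subseteq> cbox (\<chi> i. - 1) (\<chi> i. 1)"
    by (auto simp: twinned_points_eq ideal_points_def ideal_vector_nth mem_box_cart)
  then have "x \<in> cbox (\<chi> i. - 1) (\<chi> i. 1)"
    using assms hull_minimal convex_box(1) by blast
  then show ?thesis by (auto simp: mem_box_cart abs_le_iff minus_le_iff)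
qed

text \<open>
  If \<open>z = c x - d y\<close> is an integer point, then \<open>z = \<lfloor>c x\<rfloor> - \<lfloor>d y\<rfloor>\<close>, and the two
  rounded vectors need \<open>\<lfloor>c\<rfloor> + \<lfloor>d\<rfloor> \<le> \<lfloor>c + d\<rfloor>\<close> ideals; the origin fills the gap.
\<close>

lemma floor_decomposable_twinned_points:
  assumes "bij_betw p UNIV P" "bij_betw q UNIV Q"
  shows "floor_decomposable (twinned_points P r p Q s q)"
  unfolding floor_decomposable_def
proof (intro allI impI ballI)
  let ?A = "ideal_points P r p" and ?B = "ideal_points Q s q"
  let ?S = "twinned_points P r p Q s q"
  fix t :: real and z
  assume t: "0 \<le> t" and "z \<in> (\<lambda>x. t *\<^sub>R x) ` (convex hull ?S)" and int: "integer_point z"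
  then obtain w where w: "w \<in> convex hull ?S" "z = t *\<^sub>R w" by blast
  have "convex hull ?S = convex hull (convex hull ?A \<union> convex hull (uminus ` ?B))"
    unfolding twinned_points_eq by (rule hull_Un) (auto intro: convex_Inter)
  also have "convex hull (uminus ` ?B) = uminus ` (convex hull ?B)"
    by (rule convex_hull_linear_image[symmetric]) (simp add: linear_iff)
  finally have "w \<in> convex hull (convex hull ?A \<union> uminus ` (convex hull ?B))"
    using w(1) by simp
  moreover have "?A \<noteq> {}" "?B \<noteq> {}"
    using zero_in_ideal_points by blast+
  ultimately have "w \<in> {a *\<^sub>R x + b *\<^sub>R y' | a b x y'.
      a \<ge> 0 \<and> b \<ge> 0 \<and> a + b = 1 \<and> x \<in> convex hull ?A \<and> y' \<in> uminus ` (convex hull ?B)}"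
    by (subst (asm) convex_hull_union_two) (auto simp: convex_negations)
  then obtain a b x y' where ab: "0 \<le> a" "0 \<le> b" "a + b = 1"
    and xy': "x \<in> convex hull ?A" "y' \<in> uminus ` (convex hull ?B)" "w = a *\<^sub>R x + b *\<^sub>R y'"
    by blast
  then obtain y where "y' = - y" "y \<in> convex hull ?B"
    by blast
  with xy' have xy: "x \<in> convex hull ?A" "y \<in> convex hull ?B" and w': "w = a *\<^sub>R x - b *\<^sub>R y"
    by auto
  obtain xs where xs: "set xs \<subseteq> ?A" "length xs = nat \<lfloor>t * a\<rfloor>"
      "sum_list xs = (\<chi> i. of_int \<lfloor>t * a * x $ i\<rfloor>)"
    using floor_of_dilated_order_polytope[OF assms(1) xy(1), of "t * a"] t ab by auto
  obtain ys where ys: "set ys \<subseteq> ?B" "length ys = nat \<lfloor>t * b\<rfloor>"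
      "sum_list ys = (\<chi> i. of_int \<lfloor>t * b * y $ i\<rfloor>)"
    using floor_of_dilated_order_polytope[OF assms(2) xy(2), of "t * b"] t ab by auto
  have z: "z = sum_list xs - sum_list ys"
    unfolding vec_eq_iff
  proof
    fix i
    obtain k where k: "z $ i = of_int k"
      using int by (auto simp: integer_point_def elim: Ints_cases)
    then have "t * a * x $ i = of_int k + t * b * y $ i"
      using w(2) w' by (simp add: algebra_simps)
    then show "z $ i = (sum_list xs - sum_list ys) $ i"
      using k by (simp add: xs(3) ys(3))
  qed
  have "\<lfloor>t * a\<rfloor> + \<lfloor>t * b\<rfloor> \<le> \<lfloor>t * a + t * b\<rfloor>"
    by (rule le_floor_add)
  also have "t * a + t * b = t"
    using ab(3) by (metis distrib_left mult.right_neutral)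
  finally have len: "length xs + length ys \<le> nat \<lfloor>t\<rfloor>"
    using xs(2) ys(2) t ab by (simp flip: nat_add_distrib)
  define zs where "zs = xs @ map uminus ys @ replicate (nat \<lfloor>t\<rfloor> - (length xs + length ys)) 0"
  have "set zs \<subseteq> ?S"
    using xs(1) ys(1) zero_in_ideal_points[of P r p] by (auto simp: zs_def twinned_points_eq)
  moreover have "length zs = nat \<lfloor>t\<rfloor>"
    using len by (simp add: zs_def)
  moreover have "sum_list (map uminus ys) = - sum_list ys"
    by (induction ys) auto
  then have "z = sum_list zs"
    using z by (simp add: zs_def sum_list_replicate)
  ultimately show "\<exists>xs. set xs \<subseteq> ?S \<and> length xs = nat \<lfloor>t\<rfloor> \<and> z = sum_list xs"
    by blast
qed

section \<open>The origin as the unique interior integer point\<close>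

lemma zero_interior_of_axes:
  fixes D :: "(real ^ 'n::finite) set"
  assumes "convex D" "0 < \<epsilon>" "\<And>i. \<epsilon> *\<^sub>R axis i 1 \<in> D" "\<And>i. - (\<epsilon> *\<^sub>R axis i 1) \<in> D"
  shows "0 \<in> interior D"
proof -
  let ?d = "real CARD('n)"
  have segment: "c *\<^sub>R axis i 1 \<in> D" if "\<bar>c\<bar> \<le> \<epsilon>" for c i
  proof -
    define m where "m = (1 + c / \<epsilon>) / 2"
    have "0 \<le> m" "m \<le> 1"
      using that assms(2) by (auto simp: m_def field_simps)
    then have "m *\<^sub>R (\<epsilon> *\<^sub>R axis i 1) + (1 - m) *\<^sub>R (- (\<epsilon> *\<^sub>R axis i 1)) \<in> D"
      using assms by (intro convexD) auto
    also have "m *\<^sub>R (\<epsilon> *\<^sub>R axis i 1) + (1 - m) *\<^sub>R (- (\<epsilon> *\<^sub>R axis i 1))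
        = ((2 * m - 1) * \<epsilon>) *\<^sub>R (axis i 1 :: real ^ 'n)"
      by (simp add: vec_eq_iff algebra_simps)
    also have "(2 * m - 1) * \<epsilon> = c"
      using assms(2) by (simp add: m_def field_simps)
    finally show ?thesis .
  qed
  have "ball 0 (\<epsilon> / ?d) \<subseteq> D"
  proof
    fix x :: "real ^ 'n" assume "x \<in> ball 0 (\<epsilon> / ?d)"
    then have "norm x < \<epsilon> / ?d" by simp
    then have norm: "norm x * ?d < \<epsilon>"
      by (subst (asm) pos_less_divide_eq) auto
    have "\<bar>?d * x $ i\<bar> \<le> \<epsilon>" for i
    proof -
      have "\<bar>?d * x $ i\<bar> \<le> norm x * ?d"
        using component_le_norm_cart[of x i] by (simp add: abs_mult)
      then show ?thesis using norm by linarith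
    qed
    then have "(\<Sum>i\<in>UNIV. (1 / ?d) *\<^sub>R ((?d * x $ i) *\<^sub>R axis i 1)) \<in> D"
      using segment assms(1) by (intro convex_sum) auto
    then show "x \<in> D"
      using basis_expansion[of x] by (simp add: scalar_mult_eq_scaleR)
  qed
  then show ?thesis
    using assms(2) by (meson mem_interior divide_pos_pos of_nat_0_less_iff zero_less_card_finite)
qed

lemma initial_segment_poset_ideal:
  fixes p :: "'n::finite \<Rightarrow> 'a"
  assumes "bij_betw p UNIV P" "linear_extension r p \<sigma>" "k \<le> CARD('n)"
  shows "poset_ideal P r (p ` \<sigma> ` {1..k})"
  unfolding poset_ideal_def
proof (intro conjI ballI impI)
  show "p ` \<sigma> ` {1..k} \<subseteq> P"
    using assms(1) by (auto simp: bij_betw_def)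
next
  fix x y assume x: "x \<in> p ` \<sigma> ` {1..k}" and y: "y \<in> P" "(y, x) \<in> r"
  from x obtain b where b: "b \<in> {1..k}" "x = p (\<sigma> b)" by blast
  have "bij_betw \<sigma> {1..CARD('n)} UNIV"
    using assms(2) by (simp add: linear_extension_def)
  then obtain a where a: "a \<in> {1..CARD('n)}" "y = p (\<sigma> a)"
    using y(1) assms(1) by (metis bij_betw_imp_surj_on imageE UNIV_I)
  show "y \<in> p ` \<sigma> ` {1..k}"
  proof (cases "y = x")
    case False
    then have "a < b"
      using assms(2,3) a b y(2) by (auto simp: linear_extension_def)
    then show ?thesis using a b by auto
  qed (use x in simp)
qed

lemma initial_segment_in_ideal_points:
  fixes p :: "'n::finite \<Rightarrow> 'a"
  assumes "bij_betw p UNIV P" "linear_extension r p \<sigma>" "k \<le> CARD('n)"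
  shows "(\<chi> i. of_bool (i \<in> \<sigma> ` {1..k})) \<in> ideal_points P r p"
proof -
  have "inj p" using assms(1) by (simp add: bij_betw_def)
  then have "(\<chi> i. of_bool (i \<in> \<sigma> ` {1..k})) = ideal_vector p (p ` \<sigma> ` {1..k})"
    by (simp add: vec_eq_iff ideal_vector_nth inj_image_mem_iff del: image_image)
  then show ?thesis
    using initial_segment_poset_ideal[OF assms] by (auto simp: ideal_points_def)
qed

lemma zero_interior_twinned_order_polytope:
  fixes p :: "'n::finite \<Rightarrow> 'a" and q :: "'n \<Rightarrow> 'b"
  assumes p: "bij_betw p UNIV P" and q: "bij_betw q UNIV Q"
    and "common_linear_extension r p s q"
  shows "0 \<in> interior (convex hull (twinned_points P r p Q s q))"
proof -
  let ?S = "twinned_points P r p Q s q"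
  obtain \<sigma> where \<sigma>: "linear_extension r p \<sigma>" "linear_extension s q \<sigma>"
    using assms(3) by (auto simp: common_linear_extension_def)
  then have bij: "bij_betw \<sigma> {1..CARD('n)} UNIV" by (simp add: linear_extension_def)
  define V :: "nat \<Rightarrow> real ^ 'n" where "V k = (\<chi> i. of_bool (i \<in> \<sigma> ` {1..k}))" for k
  have V: "V k \<in> ?S" "- V k \<in> ?S" if "k \<le> CARD('n)" for k
    using initial_segment_in_ideal_points[OF p \<sigma>(1) that]
      initial_segment_in_ideal_points[OF q \<sigma>(2) that]
    by (auto simp: twinned_points_eq V_def)
  have half_diff: "(1/2) *\<^sub>R (V k - V l) \<in> convex hull ?S"
    if "k \<le> CARD('n)" "l \<le> CARD('n)" for k l
  proof -
    have "(1/2) *\<^sub>R V k + (1/2) *\<^sub>R (- V l) \<in> convex hull ?S"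
      using V that by (intro convexD[OF convex_convex_hull]) (auto simp: hull_inc)
    then show ?thesis by (simp add: algebra_simps)
  qed
  have axis: "\<exists>k<CARD('n). axis i 1 = V (Suc k) - V k" for i
  proof -
    obtain k' where "k' \<in> {1..CARD('n)}" "i = \<sigma> k'"
      using bij by (metis bij_betw_imp_surj_on imageE UNIV_I)
    then obtain k where k: "k < CARD('n)" "i = \<sigma> (Suc k)"
      by (cases k') (auto dest: Suc_le_lessD)
    have "\<sigma> (Suc k) \<notin> \<sigma> ` {1..k}"
      using bij k(1) by (subst inj_on_image_mem_iff[of \<sigma> "{1..CARD('n)}"]) (auto simp: bij_betw_def)
    then have "axis i 1 = V (Suc k) - V k"
      using k(2) by (auto simp: vec_eq_iff V_def axis_def atLeastAtMostSuc_conv)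
    then show ?thesis using k(1) by blast
  qed
  show ?thesis
  proof (rule zero_interior_of_axes[of _ "1/2"])
    fix i
    obtain k where k: "k < CARD('n)" "axis i 1 = V (Suc k) - V k"
      using axis by blast
    then show "(1/2) *\<^sub>R axis i 1 \<in> convex hull ?S"
      using half_diff[of "Suc k" k] by simp
    have "- ((1/2) *\<^sub>R axis i 1) = (1/2) *\<^sub>R (V k - V (Suc k))"
      using k(2) by (simp add: scaleR_diff_right)
    then show "- ((1/2) *\<^sub>R axis i 1) \<in> convex hull ?S"
      using half_diff[of k "Suc k"] k(1) by simp
  qed auto
qed

lemma interior_cube_integer_point:
  fixes D :: "(real ^ 'n::finite) set"
  assumes "\<And>x i. x \<in> D \<Longrightarrow> \<bar>x $ i\<bar> \<le> 1" "z \<in> interior D" "integer_point z"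
  shows "z = 0"
proof -
  obtain e where e: "0 < e" "cball z e \<subseteq> D"
    using assms(2) by (meson mem_interior_cball)
  have "z $ i = 0" for i
  proof -
    have "z + c *\<^sub>R axis i 1 \<in> D" if "\<bar>c\<bar> = e" for c
      using that e by (intro subsetD[OF e(2)]) (simp add: dist_norm)
    from assms(1)[OF this[of e], of i] assms(1)[OF this[of "- e"], of i]
    have "\<bar>z $ i\<bar> < 1"
      using e(1) by (simp add: axis_def)
    moreover have "z $ i \<in> \<int>"
      using assms(3) by (simp add: integer_point_def)
    ultimately show ?thesis
      by (metis Ints_nonzero_abs_less1)
  qed
  then show ?thesis by (simp add: vec_eq_iff)
qed

section \<open>Twinned order polytopes are normal and Gorenstein Fano\<close>

theorem corollary2p2:
  fixes P :: "'a set" and leP :: "'a rel" and p :: "'n::finite \<Rightarrow> 'a"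
    and Q :: "'b set" and leQ :: "'b rel" and q :: "'n \<Rightarrow> 'b"
  assumes "partial_order_on P leP" and "bij_betw p UNIV P"
    and "partial_order_on Q leQ" and "bij_betw q UNIV Q"
    and "common_linear_extension leP p leQ q"
  shows "normal_polytope (twinned_order_polytope P leP p Q leQ q)
       \<and> gorenstein_fano_polytope (twinned_order_polytope P leP p Q leQ q)"
proof -
  let ?S = "twinned_points P leP p Q leQ q"
  let ?D = "convex hull ?S"
  have "finite P" "finite Q"
    using bij_betw_finite[OF assms(2)] bij_betw_finite[OF assms(4)] by simp_all
  then have fin: "finite ?S"
    by (simp add: twinned_points_eq finite_ideal_points)
  note int = integer_point_twinned_points[of _ P leP p Q leQ q]
  note dec = floor_decomposable_twinned_points[OF assms(2,4), of leP leQ]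
  have zero: "0 \<in> interior ?D"
    using zero_interior_twinned_order_polytope assms by blast
  have "aff_dim ?D = int CARD('n)"
    using aff_dim_nonempty_interior[of ?D] zero by auto
  moreover have "{x \<in> interior ?D. integer_point x} = {0}"
    using zero interior_cube_integer_point[OF twinned_order_polytope_in_cube]
    by (auto simp: integer_point_def)
  ultimately have "fano_polytope ?D"
    using integral_polytope_convex_hull[OF fin int] by (simp add: fano_polytope_def)
  moreover have "integral_polytope (dual_polytope ?D)"
    by (rule integral_polytope_dual_polytope[OF fin int dec zero])
  moreover have "normal_polytope ?D"
    by (rule normal_polytope_convex_hull[OF fin int dec])
  ultimately show ?thesis
    by (simp add: twinned_order_polytope_def gorenstein_fano_polytope_def)
qed

end
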